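(* Let $V$ be a smooth $F$-module such that $z$ acts on $V$ as a scalar $\lambda\in\mathbb{C}^*$. Then $V$ is completely reducible.
   Context: All vector spaces and algebras are over $\mathbb{C}$; $\mathbb{C}^*$ is the set of nonzero complex numbers. Modules over Lie superalgebras are $\mathbb{Z}_2$-graded; simple means having no nonzero proper graded submodule, and completely reducible means being a direct sum of simple (graded) submodules. The Fermion algebra $F$ is the Lie superalgebra with basis $\{\psi_m, z: m\in\mathbb{Z}\}$, the $\psi_m$ odd and $z$ even, with $[\psi_m,\psi_n]=\delta_{m,-n}z$ and $[F,z]=0$. An $F$-module $V$ is smooth if for every $v\in V$ there is a non-negative integer $n$ with $\psi_iv=0$ for all $i>n$. *)

theory Defs
  imports Complex_Main "HOL-Library.Poly_Mapping" "HOL-Library.Z2"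
begin

section \<open>Super vector spaces\<close>

text \<open>The type \<open>bit\<close> is the field with two elements, used here as the group of parities:
  \<open>part 0\<close> is the even part and \<open>part 1\<close> the odd part.\<close>

locale super_vector_space = vector_space scale
  for scale :: "complex \<Rightarrow> 'a::ab_group_add \<Rightarrow> 'a" +
  fixes part :: "bit \<Rightarrow> 'a set"
  assumes subspace_part: "subspace (part i)"
    and part_Int: "part 0 \<inter> part 1 = {0}"
    and part_sum: "\<exists>a\<in>part 0. \<exists>b\<in>part 1. x = a + b"

definition koszul_sign :: "bit \<Rightarrow> bit \<Rightarrow> complex" where
  "koszul_sign i j = (if i = 1 \<and> j = 1 then -1 else 1)"

section \<open>Lie superalgebras and their modules\<close>

locale lie_superalgebra = super_vector_space scale part
  for scale :: "complex \<Rightarrow> 'g::ab_group_add \<Rightarrow> 'g" and part :: "bit \<Rightarrow> 'g set" +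
  fixes br :: "'g \<Rightarrow> 'g \<Rightarrow> 'g"
  assumes br_linear_right: "Vector_Spaces.linear scale scale (\<lambda>y. br x y)"
    and br_linear_left: "Vector_Spaces.linear scale scale (\<lambda>x. br x y)"
    and br_part: "x \<in> part i \<Longrightarrow> y \<in> part j \<Longrightarrow> br x y \<in> part (i + j)"
    and br_skew: "x \<in> part i \<Longrightarrow> y \<in> part j \<Longrightarrow>
      br x y = scale (- koszul_sign i j) (br y x)"
    and br_jacobi: "x \<in> part i \<Longrightarrow> y \<in> part j \<Longrightarrow> w \<in> part k \<Longrightarrow>
      br x (br y w) = br (br x y) w + scale (koszul_sign i j) (br y (br x w))"

locale lie_supermodule =
  g: lie_superalgebra gscale gpart br + super_vector_space scale part
  for gscale :: "complex \<Rightarrow> 'g::ab_group_add \<Rightarrow> 'g" and gpart :: "bit \<Rightarrow> 'g set"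
    and br :: "'g \<Rightarrow> 'g \<Rightarrow> 'g"
    and scale :: "complex \<Rightarrow> 'v::ab_group_add \<Rightarrow> 'v" and part :: "bit \<Rightarrow> 'v set" +
  fixes act :: "'g \<Rightarrow> 'v \<Rightarrow> 'v"
  assumes act_linear_right: "Vector_Spaces.linear scale scale (\<lambda>v. act x v)"
    and act_linear_left: "Vector_Spaces.linear gscale scale (\<lambda>x. act x v)"
    and act_part: "x \<in> gpart i \<Longrightarrow> v \<in> part j \<Longrightarrow> act x v \<in> part (i + j)"
    and act_br: "x \<in> gpart i \<Longrightarrow> y \<in> gpart j \<Longrightarrow>
      act (br x y) v = act x (act y v) - scale (koszul_sign i j) (act y (act x v))"

definition graded_submodule ::
  "(complex \<Rightarrow> 'v::ab_group_add \<Rightarrow> 'v) \<Rightarrow> (bit \<Rightarrow> 'v set) \<Rightarrow> ('g \<Rightarrow> 'v \<Rightarrow> 'v) \<Rightarrow> 'v set \<Rightarrow> bool"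
where
  "graded_submodule scale part act W \<longleftrightarrow>
     module.subspace scale W \<and>
     (\<forall>x. \<forall>w\<in>W. act x w \<in> W) \<and>
     (\<forall>w\<in>W. \<exists>a\<in>W \<inter> part 0. \<exists>b\<in>W \<inter> part 1. w = a + b)"

definition simple_graded_submodule ::
  "(complex \<Rightarrow> 'v::ab_group_add \<Rightarrow> 'v) \<Rightarrow> (bit \<Rightarrow> 'v set) \<Rightarrow> ('g \<Rightarrow> 'v \<Rightarrow> 'v) \<Rightarrow> 'v set \<Rightarrow> bool"
where
  "simple_graded_submodule scale part act W \<longleftrightarrow>
     graded_submodule scale part act W \<and> W \<noteq> {0} \<and>
     (\<forall>U. graded_submodule scale part act U \<and> U \<subseteq> W \<longrightarrow> U = {0} \<or> U = W)"

text \<open>The ambient space is the internal direct sum of the members of \<open>S\<close>: every vector is in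
  exactly one way a finite sum of components \<open>f W \<in> W\<close>.\<close>

definition is_direct_sum :: "'v::ab_group_add set set \<Rightarrow> bool" where
  "is_direct_sum S \<longleftrightarrow>
     (\<forall>v. \<exists>!f. (\<forall>W\<in>S. f W \<in> W) \<and> (\<forall>W. W \<notin> S \<longrightarrow> f W = 0) \<and>
               finite {W. f W \<noteq> 0} \<and> v = (\<Sum>W | f W \<noteq> 0. f W))"

text \<open>The direct sum may be indexed by the set of its summands, since simple submodules are
  nonzero and hence the summands of a direct sum are pairwise distinct.\<close>

definition completely_reducible ::
  "(complex \<Rightarrow> 'v::ab_group_add \<Rightarrow> 'v) \<Rightarrow> (bit \<Rightarrow> 'v set) \<Rightarrow> ('g \<Rightarrow> 'v \<Rightarrow> 'v) \<Rightarrow> bool"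
where
  "completely_reducible scale part act \<longleftrightarrow>
     (\<exists>S. (\<forall>W\<in>S. simple_graded_submodule scale part act W) \<and> is_direct_sum S)"

section \<open>The Fermion algebra\<close>

text \<open>The underlying vector space is the space of finitely supported functions on the basis.\<close>

datatype fermion_basis = Psi int | Z

type_synonym fermion = "fermion_basis \<Rightarrow>\<^sub>0 complex"

definition psi :: "int \<Rightarrow> fermion" where
  "psi m = Poly_Mapping.single (Psi m) 1"

definition zF :: fermion where
  "zF = Poly_Mapping.single Z 1"

definition fscale :: "complex \<Rightarrow> fermion \<Rightarrow> fermion" where
  "fscale c x = Poly_Mapping.map (\<lambda>a. c * a) x"

definition fpart :: "bit \<Rightarrow> fermion set" where
  "fpart i = {x. Poly_Mapping.keys x \<subseteq> (if i = 0 then {Z} else range Psi)}"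

text \<open>The bilinear extension of \<open>[psi m, psi n] = (if m = - n then z else 0)\<close> and \<open>[F, z] = [z, F] = 0\<close>;
  see \<open>fbr_psi_psi\<close>, \<open>fbr_zF\<close> and the interpretation below.\<close>

definition fbr :: "fermion \<Rightarrow> fermion \<Rightarrow> fermion" where
  "fbr x y = fscale (\<Sum>m | Psi m \<in> Poly_Mapping.keys x.
     Poly_Mapping.lookup x (Psi m) * Poly_Mapping.lookup y (Psi (- m))) zF"

lemma lookup_fscale [simp]:
  "Poly_Mapping.lookup (fscale c x) k = c * Poly_Mapping.lookup x k"
  by (simp add: fscale_def Poly_Mapping.map.rep_eq when_def)

lemma vector_space_fscale: "vector_space fscale"
  by unfold_locales (auto intro!: poly_mapping_eqI simp: lookup_add algebra_simps)

lemma finite_Psi_keys [simp]: "finite {m. Psi m \<in> Poly_Mapping.keys x}"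
proof -
  have "finite (Psi -` Poly_Mapping.keys x)"
    by (rule finite_vimageI) (auto simp: inj_def)
  then show ?thesis by (simp add: vimage_def)
qed

lemma fbr_superset:
  assumes "finite A" "{m. Psi m \<in> Poly_Mapping.keys x} \<subseteq> A"
  shows "fbr x y = fscale (\<Sum>m\<in>A.
     Poly_Mapping.lookup x (Psi m) * Poly_Mapping.lookup y (Psi (- m))) zF"
proof -
  have "(\<Sum>m | Psi m \<in> Poly_Mapping.keys x.
      Poly_Mapping.lookup x (Psi m) * Poly_Mapping.lookup y (Psi (- m))) =
    (\<Sum>m\<in>A. Poly_Mapping.lookup x (Psi m) * Poly_Mapping.lookup y (Psi (- m)))"
    by (rule sum.mono_neutral_left) (use assms in \<open>auto simp: in_keys_iff\<close>)
  then show ?thesis by (simp add: fbr_def)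
qed

lemma fbr_psi_psi: "fbr (psi m) (psi n) = (if m = - n then zF else 0)"
  by (subst fbr_superset[of "{m}"])
    (auto simp: psi_def zF_def lookup_single when_def intro!: poly_mapping_eqI split: if_splits)

lemma fbr_eq_0:
  assumes "\<And>m. Poly_Mapping.lookup x (Psi m) = 0 \<or> Poly_Mapping.lookup y (Psi (- m)) = 0"
  shows "fbr x y = 0"
proof -
  have "(\<Sum>m | Psi m \<in> Poly_Mapping.keys x.
     Poly_Mapping.lookup x (Psi m) * Poly_Mapping.lookup y (Psi (- m))) = 0"
    by (rule sum.neutral) (use assms in auto)
  then show ?thesis by (auto simp: fbr_def intro!: poly_mapping_eqI)
qed

lemma fbr_zF: "fbr x zF = 0" "fbr zF x = 0"
  by (auto intro!: fbr_eq_0 simp: zF_def lookup_single)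

lemma fbr_commute: "fbr x y = fbr y x"
proof -
  define A where "A = {m. Psi m \<in> Poly_Mapping.keys x} \<union> uminus ` {m. Psi m \<in> Poly_Mapping.keys y}"
  have "finite A" by (simp add: A_def)
  have "fbr x y = fscale (\<Sum>m\<in>A.
     Poly_Mapping.lookup x (Psi m) * Poly_Mapping.lookup y (Psi (- m))) zF"
    by (rule fbr_superset) (use \<open>finite A\<close> in \<open>auto simp: A_def\<close>)
  also have "(\<Sum>m\<in>A. Poly_Mapping.lookup x (Psi m) * Poly_Mapping.lookup y (Psi (- m))) =
    (\<Sum>m\<in>uminus ` A. Poly_Mapping.lookup y (Psi m) * Poly_Mapping.lookup x (Psi (- m)))"
    by (subst sum.reindex) (auto simp: mult.commute)
  also have "fscale \<dots> zF = fbr y x"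
    by (rule fbr_superset[symmetric]) (use \<open>finite A\<close> in \<open>auto simp: A_def image_Un image_image\<close>)
  finally show ?thesis .
qed

lemma fbr_linear_right: "Vector_Spaces.linear fscale fscale (\<lambda>y. fbr x y)"
  unfolding Vector_Spaces.linear_iff
proof (intro conjI allI)
  show "fbr x (y + w) = fbr x y + fbr x w" for y w
    by (rule poly_mapping_eqI) (simp add: fbr_def lookup_add algebra_simps sum.distrib)
  show "fbr x (fscale c y) = fscale c (fbr x y)" for c y
    by (rule poly_mapping_eqI)
      (simp add: fbr_def sum_distrib_left sum_distrib_right algebra_simps)
qed (rule vector_space_fscale)+

lemma fbr_fbr: "fbr x (fbr y w) = 0" "fbr (fbr x y) w = 0"
proof -
  have "Poly_Mapping.lookup (fbr a b) (Psi m) = 0" for a b m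
    by (simp add: fbr_def zF_def lookup_single)
  then show "fbr x (fbr y w) = 0" "fbr (fbr x y) w = 0"
    by (auto intro: fbr_eq_0)
qed

interpretation fermion: lie_superalgebra fscale fpart fbr
proof (intro lie_superalgebra.intro super_vector_space.intro vector_space_fscale)
  interpret vector_space fscale by (rule vector_space_fscale)
  have part_iff: "x \<in> fpart i \<longleftrightarrow>
      (if i = 0 then \<forall>m. Poly_Mapping.lookup x (Psi m) = 0 else Poly_Mapping.lookup x Z = 0)" for x i
  proof -
    have *: "k \<in> range Psi \<longleftrightarrow> k \<noteq> Z" for k by (cases k) auto
    have "Poly_Mapping.keys x \<subseteq> {Z} \<longleftrightarrow> (\<forall>m. Poly_Mapping.lookup x (Psi m) = 0)"
      by (metis fermion_basis.distinct(1) fermion_basis.exhaust in_keys_iff insert_iff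
          empty_iff subset_iff)
    moreover have "Poly_Mapping.keys x \<subseteq> range Psi \<longleftrightarrow> Poly_Mapping.lookup x Z = 0"
      using * by (metis in_keys_iff subset_iff)
    ultimately show ?thesis by (simp add: fpart_def)
  qed
  show "super_vector_space_axioms fscale fpart"
  proof
    show "subspace (fpart i)" for i
      by (auto simp: subspace_def part_iff lookup_add)
    show "fpart 0 \<inter> fpart 1 = {0}"
    proof -
      have "x = 0" if "\<forall>m. Poly_Mapping.lookup x (Psi m) = 0" "Poly_Mapping.lookup x Z = 0"
        for x :: fermion
      proof (rule poly_mapping_eqI)
        show "Poly_Mapping.lookup x k = Poly_Mapping.lookup 0 k" for k
          using that by (cases k) auto
      qed
      then show ?thesis by (auto simp: part_iff)
    qed
    fix x :: fermion
    let ?a = "Poly_Mapping.single Z (Poly_Mapping.lookup x Z)"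
    have "?a \<in> fpart 0" "x - ?a \<in> fpart 1"
      by (auto simp: part_iff lookup_single lookup_minus)
    then show "\<exists>a\<in>fpart 0. \<exists>b\<in>fpart 1. x = a + b"
      by (metis add.commute diff_add_cancel)
  qed
  show "lie_superalgebra_axioms fscale fpart fbr"
  proof (rule lie_superalgebra_axioms.intro)
    show "Vector_Spaces.linear fscale fscale (\<lambda>y. fbr x y)" for x by (rule fbr_linear_right)
    show "Vector_Spaces.linear fscale fscale (\<lambda>x. fbr x y)" for y
      using fbr_linear_right[of y] by (simp add: fbr_commute[of _ y])
    fix x y w i j k assume xy: "x \<in> fpart i" "y \<in> fpart j"
    have zero: "fbr x y = 0" if "i = 0 \<or> j = 0"
      using that xy by (intro fbr_eq_0) (auto simp: part_iff)
    show "fbr x y \<in> fpart (i + j)"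
    proof (cases "i = 0 \<or> j = 0")
      case True
      then show ?thesis using zero by (auto simp: part_iff)
    next
      case False
      then have "i + j = 0" by simp
      then show ?thesis by (auto simp: part_iff fbr_def zF_def lookup_single)
    qed
    show "fbr x y = fscale (- koszul_sign i j) (fbr y x)"
    proof (cases "i = 0 \<or> j = 0")
      case True
      then show ?thesis using zero by (simp add: fbr_commute[of y])
    next
      case False
      then show ?thesis by (simp add: koszul_sign_def fbr_commute[of y])
    qed
    show "fbr x (fbr y w) = fbr (fbr x y) w + fscale (koszul_sign i j) (fbr y (fbr x w))"
      by (simp add: fbr_fbr)
  qed
qed

locale fermion_module = lie_supermodule fscale fpart fbr scale part act
  for scale :: "complex \<Rightarrow> 'v::ab_group_add \<Rightarrow> 'v" and part :: "bit \<Rightarrow> 'v set"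
    and act :: "fermion \<Rightarrow> 'v \<Rightarrow> 'v"

definition smooth :: "(fermion \<Rightarrow> 'v::ab_group_add \<Rightarrow> 'v) \<Rightarrow> bool" where
  "smooth act \<longleftrightarrow> (\<forall>v. \<exists>n::nat. \<forall>i > int n. act (psi i) v = 0)"

end

theory Submission
  imports Defs
begin

text \<open>Call a vector killed by all \<open>\<psi>\<^sub>n\<close>, \<open>n > 0\<close>, a vacuum vector, and let \<open>E\<close> be the
  space of even vacuum vectors. The operators \<open>p\<^sub>n = \<lambda>\<inverse> \<psi>\<^sub>n \<psi>\<^sub>-\<^sub>n\<close> and \<open>1 - p\<^sub>n = \<lambda>\<inverse> \<psi>\<^sub>-\<^sub>n \<psi>\<^sub>n\<close>
  are complementary projections. Splitting a vector of a graded submodule \<open>U\<close> along them, for the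
  finitely many \<open>n\<close> that matter by smoothness, shows that \<open>U\<close> is generated by its vacuum vectors,
  hence by \<open>U \<inter> E\<close> since \<open>\<psi>\<^sub>0\<^sup>2 = \<lambda>/2\<close> is invertible. Conversely the product of the \<open>p\<^sub>n\<close>
  fixes the vacuum vectors, commutes with \<open>\<psi>\<^sub>0\<close> and kills every \<open>\<psi>\<^sub>-\<^sub>n v\<close>, so that the
  submodule generated by \<open>S \<subseteq> E\<close> meets \<open>E\<close> in the span of \<open>S\<close>. Thus graded submodules
  correspond to subspaces of \<open>E\<close>, and a basis of \<open>E\<close> yields a decomposition into simples.\<close>

section \<open>Internal direct sums\<close>

context vector_space
begin

text \<open>Existence follows by induction over the span. Two decompositions of a vector differ by
  one of 0, whose component at \<open>W\<close> is minus the sum of the others, hence lies in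
  \<open>W\<close> and in the span of the remaining summands.\<close>

lemma is_direct_sumI:
  assumes subspace: "\<And>W. W \<in> S \<Longrightarrow> subspace W"
    and spanning: "span (\<Union>S) = UNIV"
    and indep: "\<And>W. W \<in> S \<Longrightarrow> W \<inter> span (\<Union>(S - {W})) \<subseteq> {0}"
  shows "is_direct_sum S"
proof -
  define dec where "dec v f \<longleftrightarrow> (\<forall>W\<in>S. f W \<in> W) \<and> (\<forall>W. W \<notin> S \<longrightarrow> f W = 0) \<and>
    finite {W. f W \<noteq> 0} \<and> v = (\<Sum>W | f W \<noteq> 0. f W)" for v and f :: "'b set \<Rightarrow> 'b"
  have superset: "(\<Sum>W | f W \<noteq> 0. f W) = (\<Sum>W\<in>A. f W)"
    if "finite A" "{W. f W \<noteq> 0} \<subseteq> A" for f :: "'b set \<Rightarrow> 'b" and A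
    by (rule sum.mono_neutral_left) (use that in auto)
  \<comment> \<open>Used with \<open>l = 1\<close> for existence and with coefficients 1 and -1 for
    uniqueness.\<close>
  have dec_lin: "dec (scale k v + scale l w) (\<lambda>W. scale k (f W) + scale l (g W))"
    if f: "dec v f" and g: "dec w g" for k l v w f g
  proof -
    let ?h = "\<lambda>W. scale k (f W) + scale l (g W)"
    define A where "A = {W. f W \<noteq> 0} \<union> {W. g W \<noteq> 0}"
    have A: "finite A" "{W. f W \<noteq> 0} \<subseteq> A" "{W. g W \<noteq> 0} \<subseteq> A" "{W. ?h W \<noteq> 0} \<subseteq> A"
      using f g by (auto simp: A_def dec_def)
    have "v = (\<Sum>W\<in>A. f W)" "w = (\<Sum>W\<in>A. g W)"
      using f g superset[OF A(1,2)] superset[OF A(1,3)] by (auto simp: dec_def)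
    then have "scale k v + scale l w = (\<Sum>W\<in>A. ?h W)"
      by (simp add: sum.distrib scale_sum_right)
    with A superset[OF A(1,4)] finite_subset[OF A(4,1)] f g subspace show ?thesis
      by (auto simp: dec_def subspace_add subspace_scale)
  qed
  have ex: "\<exists>f. dec v f" for v
  proof -
    have "v \<in> span (\<Union>S)" using spanning by simp
    then show ?thesis
    proof (induction rule: span_induct_alt)
      case base
      have "dec 0 (\<lambda>_. 0)" using subspace by (auto simp: dec_def subspace_0)
      then show ?case by blast
    next
      case (step k x y)
      then obtain W g where W: "W \<in> S" "x \<in> W" and g: "dec y g" by auto
      have "dec x (\<lambda>V. if V = W then x else 0)"
        using W subspace superset[of "{W}" "\<lambda>V. if V = W then x else 0"]
        by (auto simp: dec_def subspace_0)
      from dec_lin[OF this g, of k 1] show ?case by auto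
    qed
  qed
  have uniq: "f = g" if f: "dec v f" and g: "dec v g" for v f g
  proof
    fix W
    have h: "dec 0 (\<lambda>V. f V - g V)"
      using dec_lin[OF f g, of 1 "-1"] by simp
    show "f W = g W"
    proof (cases "W \<in> S")
      case True
      define A where "A = insert W {V. f V - g V \<noteq> 0}"
      have A: "finite A" using h by (auto simp: dec_def A_def)
      have "(\<Sum>V\<in>A. f V - g V) = 0"
        using h superset[of A "\<lambda>V. f V - g V"] A by (auto simp: dec_def A_def)
      then have "f W - g W = - (\<Sum>V\<in>A - {W}. f V - g V)"
        using sum.remove[OF A, of W "\<lambda>V. f V - g V"]
        by (simp add: A_def eq_neg_iff_add_eq_0)
      also have "\<dots> \<in> span (\<Union>(S - {W}))"
      proof (intro span_neg span_sum)
        fix V assume V: "V \<in> A - {W}"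
        then have "V \<in> S" using h True by (auto simp: dec_def A_def)
        then have "f V - g V \<in> V" using h by (auto simp: dec_def)
        with V \<open>V \<in> S\<close> show "f V - g V \<in> span (\<Union>(S - {W}))"
          by (intro span_base) blast
      qed
      finally have "f W - g W \<in> W \<inter> span (\<Union>(S - {W}))"
        using h True by (auto simp: dec_def)
      with indep[OF True] show ?thesis by auto
    next
      case False
      then show ?thesis using f g by (auto simp: dec_def)
    qed
  qed
  show ?thesis
    unfolding is_direct_sum_def dec_def[symmetric] using ex uniq by blast
qed

end

section \<open>Graded submodules\<close>

context super_vector_space
begin

lemma parts_eq:
  assumes "a + b = a' + b'" "a \<in> part 0" "a' \<in> part 0" "b \<in> part 1" "b' \<in> part 1"
  shows "a = a'" "b = b'"
proof -
  have "a - a' = b' - b" using assms(1) by (simp add: algebra_simps)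
  moreover have "a - a' \<in> part 0" "b' - b \<in> part 1"
    using assms subspace_diff[OF subspace_part] by blast+
  ultimately have "a - a' \<in> part 0 \<inter> part 1" by simp
  then show "a = a'" using part_Int by auto
  with assms(1) show "b = b'" by simp
qed

text \<open>Parity components are unique, so the splittings in \<open>U\<close> and in
  \<open>W\<close> agree.\<close>

lemma graded_submodule_Int:
  assumes U: "graded_submodule scale part act U" and W: "graded_submodule scale part act W"
  shows "graded_submodule scale part act (U \<inter> W)"
  unfolding graded_submodule_def
proof (intro conjI allI ballI)
  show "subspace (U \<inter> W)"
    using U W by (auto simp: graded_submodule_def intro: subspace_inter)
  show "act x w \<in> U \<inter> W" if "w \<in> U \<inter> W" for x w
    using U W that by (auto simp: graded_submodule_def)
  fix w assume w: "w \<in> U \<inter> W"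
  obtain a b where ab: "a \<in> U \<inter> part 0" "b \<in> U \<inter> part 1" "w = a + b"
    using U w by (fastforce simp: graded_submodule_def)
  obtain a' b' where ab': "a' \<in> W \<inter> part 0" "b' \<in> W \<inter> part 1" "w = a' + b'"
    using W w by (fastforce simp: graded_submodule_def)
  have "a = a'" "b = b'" using parts_eq[of a b a' b'] ab ab' by auto
  with ab ab' show "\<exists>a\<in>U \<inter> W \<inter> part 0. \<exists>b\<in>U \<inter> W \<inter> part 1. w = a + b" by auto
qed

end

section \<open>Smooth modules of nonzero level\<close>

locale smooth_fermion_module = fermion_module scale part act
  for scale :: "complex \<Rightarrow> 'v::ab_group_add \<Rightarrow> 'v" and part :: "bit \<Rightarrow> 'v set"
    and act :: "fermion \<Rightarrow> 'v \<Rightarrow> 'v" +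
  fixes c :: complex
  assumes smooth: "smooth act" and level_nonzero: "c \<noteq> 0"
    and act_zF: "act zF v = scale c v"
begin

abbreviation ps :: "int \<Rightarrow> 'v \<Rightarrow> 'v" where "ps m \<equiv> act (psi m)"

section \<open>The action and the anticommutation relations\<close>

lemma act_add [simp]: "act x (v + w) = act x v + act x w"
  and act_scale [simp]: "act x (scale k v) = scale k (act x v)"
  using act_linear_right[of x] by (auto simp: Vector_Spaces.linear_iff)

lemma act_0 [simp]: "act x 0 = 0"
  using act_scale[of x 0 0] by simp

lemma act_add_left: "act (x + y) v = act x v + act y v"
  and act_fscale: "act (fscale k x) v = scale k (act x v)"
  using act_linear_left[of v] by (auto simp: Vector_Spaces.linear_iff)

lemma act_0_left [simp]: "act 0 v = 0"
  using act_add_left[of 0 0 v] by simp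

text \<open>\<open>zF\<close> acts by a scalar, so among the basis elements only the
  \<open>psi m\<close> need checking; induction on the finite support does the rest.\<close>

lemma act_closed:
  assumes W: "subspace W" and ps: "\<And>m. ps m w \<in> W" and w: "w \<in> W"
  shows "act x w \<in> W"
proof (induction x rule: update_induct)
  case const
  then show ?case using W by (simp add: subspace_0)
next
  case (update x k a)
  have "Poly_Mapping.update k a x = fscale a (Poly_Mapping.single k 1) + x"
    using update.hyps
    by (intro poly_mapping_eqI) (auto simp: lookup_add lookup_update lookup_single in_keys_iff)
  moreover have "act (Poly_Mapping.single k 1) w \<in> W"
    using ps w act_zF W by (cases k) (auto simp flip: psi_def zF_def simp: subspace_scale)
  ultimately show ?case
    using W update.IH by (simp add: act_add_left act_fscale subspace_add subspace_scale)
qed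

lemma psi_part: "psi m \<in> fpart 1"
  by (auto simp: psi_def fpart_def)

lemma ps_part: "v \<in> part j \<Longrightarrow> ps m v \<in> part (1 + j)"
  by (rule act_part[OF psi_part])

text \<open>Two odd elements have Koszul sign -1, so their bracket acts as an anticommutator; this
  form exchanges neighbouring operators.\<close>

lemma ps_ps: "ps m (ps n v) = (if m = - n then scale c v else 0) - ps n (ps m v)"
proof -
  have "(if m = - n then scale c v else 0) = ps m (ps n v) + ps n (ps m v)"
    using act_br[OF psi_part psi_part, of m n v]
    by (simp add: fbr_psi_psi koszul_sign_def act_zF split: if_splits)
  then show ?thesis by simp
qed

lemma ps_twice: "m \<noteq> 0 \<Longrightarrow> ps m (ps m v) = 0"
proof -
  assume "m \<noteq> 0"
  then have "ps m (ps m v) = - ps m (ps m v)" using ps_ps[of m m v] by simp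
  then have "ps m (ps m v) + ps m (ps m v) = 0" by (simp add: eq_neg_iff_add_eq_0)
  then have "scale 2 (ps m (ps m v)) = 0"
    using scale_left_distrib[of 1 1 "ps m (ps m v)"] by simp
  then show ?thesis by simp
qed

lemma ps_0_ps_0: "scale (2 / c) (ps 0 (ps 0 v)) = v"
proof -
  have "scale c v = ps 0 (ps 0 v) + ps 0 (ps 0 v)"
    using ps_ps[of 0 0 v] by (simp add: eq_diff_eq)
  also have "\<dots> = scale 2 (ps 0 (ps 0 v))"
    using scale_left_distrib[of 1 1 "ps 0 (ps 0 v)"] by simp
  finally have "scale (1 / c) (scale c v) = scale (1 / c) (scale 2 (ps 0 (ps 0 v)))" by simp
  then show ?thesis using level_nonzero by simp
qed

text \<open>Even vectors suffice: \<open>ps 0\<close> is odd, invertible and anticommutes with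
  \<open>ps n\<close> for \<open>n > 0\<close>, so it matches odd vacuum vectors with even
  ones.\<close>

definition vac :: "'v set" where
  "vac = {v \<in> part 0. \<forall>n>0. ps n v = 0}"

lemma vac_0_ps: "v \<in> vac \<Longrightarrow> n > 0 \<Longrightarrow> ps n (ps 0 v) = 0"
  using ps_ps[of n 0 v] by (simp add: vac_def)

lemma subspace_vac: "subspace vac"
  using subspace_part[of 0] by (auto simp: subspace_def vac_def)

subsection \<open>The submodule generated by even vacuum vectors\<close>

text \<open>Only the creation operators are needed as generators, since \<open>\<psi>\<^sub>n\<close> with \<open>n \<ge> 0\<close> can be
  moved to the right.\<close>

inductive_set gen :: "'v set \<Rightarrow> 'v set" for S where
  zero: "0 \<in> gen S"
| base: "s \<in> S \<Longrightarrow> s \<in> gen S"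
| base_ps: "s \<in> S \<Longrightarrow> ps 0 s \<in> gen S"
| add: "v \<in> gen S \<Longrightarrow> w \<in> gen S \<Longrightarrow> v + w \<in> gen S"
| scale: "v \<in> gen S \<Longrightarrow> scale k v \<in> gen S"
| neg: "v \<in> gen S \<Longrightarrow> n > 0 \<Longrightarrow> ps (- n) v \<in> gen S"

lemma subspace_gen: "subspace (gen S)"
  by (auto simp: subspace_def intro: gen.intros)

text \<open>For \<open>m \<ge> 0\<close>, moving \<open>ps m\<close> past \<open>ps (- n)\<close>
  costs a sign and at most a multiple of \<open>v\<close>. At the generators, \<open>ps m\<close>
  gives 0 if \<open>m > 0\<close>, while \<open>ps 0\<close> exchanges \<open>s\<close> and
  \<open>ps 0 s\<close> up to a scalar.\<close>

lemma gen_ps_closed: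
  assumes "S \<subseteq> vac" "v \<in> gen S"
  shows "ps m v \<in> gen S"
proof (cases "m < 0")
  case True
  then show ?thesis using gen.neg[OF assms(2), of "- m"] by simp
next
  case False
  from assms(2) show ?thesis
  proof induction
    case (base s)
    show ?case
    proof (cases "m = 0")
      case True
      then show ?thesis using base by (auto intro: gen.intros)
    next
      case m: False
      then have "ps m s = 0" using base assms(1) False by (auto simp: vac_def)
      then show ?thesis by (simp add: gen.zero)
    qed
  next
    case (base_ps s)
    show ?case
    proof (cases "m = 0")
      case True
      have "ps 0 (ps 0 s) = scale (c / 2) (scale (2 / c) (ps 0 (ps 0 s)))"
        using level_nonzero by simp
      also have "\<dots> = scale (c / 2) s" by (simp only: ps_0_ps_0)
      finally show ?thesis using True base_ps by (auto intro: gen.intros)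
    next
      case m: False
      then show ?thesis
        using vac_0_ps[of s m] base_ps assms(1) False by (simp add: subset_iff gen.zero)
    qed
  next
    case (neg v n)
    have "(if m = n then scale c v else 0) \<in> gen S"
      using neg by (auto intro: gen.intros)
    moreover have "ps (- n) (ps m v) \<in> gen S" using neg by (intro gen.neg)
    ultimately show ?case
      by (subst ps_ps) (simp add: subspace_diff[OF subspace_gen] del: if_split)
  qed (auto intro: gen.intros)
qed

lemma gen_graded:
  assumes "S \<subseteq> vac" "v \<in> gen S"
  shows "\<exists>a\<in>gen S \<inter> part 0. \<exists>b\<in>gen S \<inter> part 1. v = a + b"
  using assms(2)
proof induction
  case zero
  then show ?case using subspace_part subspace_0 by (force intro: gen.zero)
next
  case (base s)
  then have "s \<in> gen S \<inter> part 0" "0 \<in> gen S \<inter> part 1" "s = s + 0"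
    using assms(1) subspace_part subspace_0 by (auto simp: vac_def intro: gen.intros)
  then show ?case by blast
next
  case (base_ps s)
  then have "0 \<in> gen S \<inter> part 0" "ps 0 s \<in> gen S \<inter> part 1" "ps 0 s = 0 + ps 0 s"
    using assms(1) subspace_part subspace_0 ps_part[of s 0 0]
    by (auto simp: vac_def intro: gen.intros)
  then show ?case by blast
next
  case (add v w)
  then obtain a b a' b' where *: "a \<in> gen S \<inter> part 0" "b \<in> gen S \<inter> part 1" "v = a + b"
    "a' \<in> gen S \<inter> part 0" "b' \<in> gen S \<inter> part 1" "w = a' + b'" by metis
  then have "a + a' \<in> gen S \<inter> part 0" "b + b' \<in> gen S \<inter> part 1" "v + w = (a + a') + (b + b')"
    using subspace_add[OF subspace_part] by (auto intro: gen.add simp: algebra_simps)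
  then show ?case by blast
next
  case (scale v k)
  then obtain a b where *: "a \<in> gen S \<inter> part 0" "b \<in> gen S \<inter> part 1" "v = a + b" by metis
  then have "scale k a \<in> gen S \<inter> part 0" "scale k b \<in> gen S \<inter> part 1"
    "scale k v = scale k a + scale k b"
    using subspace_scale[OF subspace_part] by (auto intro: gen.scale simp: scale_right_distrib)
  then show ?case by blast
next
  case (neg v n)
  then obtain a b where *: "a \<in> gen S \<inter> part 0" "b \<in> gen S \<inter> part 1" "v = a + b" by metis
  \<comment> \<open>\<open>ps (- n)\<close> is odd, so the two components change places.\<close>
  then have "ps (- n) b \<in> gen S \<inter> part 0" "ps (- n) a \<in> gen S \<inter> part 1"
    "ps (- n) v = ps (- n) b + ps (- n) a"
    using ps_part[of b 1] ps_part[of a 0] neg by (auto intro: gen.neg simp: add.commute)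
  then show ?case by blast
qed

lemma graded_submodule_gen:
  assumes "S \<subseteq> vac"
  shows "graded_submodule scale part act (gen S)"
  unfolding graded_submodule_def
  using assms subspace_gen act_closed[OF subspace_gen] gen_ps_closed gen_graded by blast

lemma gen_minimal:
  assumes "subspace U" "\<And>m v. v \<in> U \<Longrightarrow> ps m v \<in> U" "S \<subseteq> U"
  shows "gen S \<subseteq> U"
proof
  fix v assume "v \<in> gen S"
  then show "v \<in> U"
    by induction (use assms in \<open>auto simp: subspace_0 subspace_add subspace_scale\<close>)
qed

text \<open>Induction on a bound \<open>n\<close> above which every \<open>ps i\<close> kills
  \<open>v\<close>. The anticommutator of \<open>ps ?m\<close> and \<open>ps (- ?m)\<close> writes
  \<open>scale c v\<close> through vectors with a smaller bound.\<close>

lemma graded_submodule_subset_gen: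
  assumes U: "graded_submodule scale part act U"
  shows "U \<subseteq> gen (U \<inter> vac)"
proof
  fix v assume v: "v \<in> U"
  have sub: "subspace U" and ps: "\<And>m w. w \<in> U \<Longrightarrow> ps m w \<in> U"
    using U by (auto simp: graded_submodule_def)
  have gen_ps: "ps m w \<in> gen (U \<inter> vac)" if "w \<in> gen (U \<inter> vac)" for m w
    using that gen_ps_closed by blast
  obtain n where n: "\<forall>i>int n. ps i v = 0" using smooth by (auto simp: smooth_def)
  from v n show "v \<in> gen (U \<inter> vac)"
  proof (induction n arbitrary: v)
    case 0
    obtain a b where ab: "a \<in> U \<inter> part 0" "b \<in> U \<inter> part 1" "v = a + b"
      using U 0 by (fastforce simp: graded_submodule_def)
    \<comment> \<open>\<open>ps i b\<close> and \<open>ps i a\<close> are the even and odd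
      components of \<open>ps i v = 0\<close>.\<close>
    have zero: "ps i a = 0" "ps i b = 0" if "i > 0" for i
    proof -
      have "ps i b + ps i a = 0 + 0" using 0 that ab by (simp add: add.commute)
      then show "ps i a = 0" "ps i b = 0"
        using parts_eq[of "ps i b" "ps i a" 0 0] ps_part[of b 1 i] ps_part[of a 0 i] ab
          subspace_0[OF subspace_part] by auto
    qed
    have "a \<in> U \<inter> vac" using ab zero by (auto simp: vac_def)
    \<comment> \<open>The odd component is recovered from an even vacuum vector by inverting
      \<open>ps 0\<close>.\<close>
    moreover have "ps 0 b \<in> U \<inter> vac"
      using ab ps zero ps_part[of b 1 0] ps_ps[of _ 0 b] by (auto simp: vac_def)
    then have "scale (2 / c) (ps 0 (ps 0 b)) \<in> gen (U \<inter> vac)"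
      by (intro gen.intros)
    then have "b \<in> gen (U \<inter> vac)" by (simp only: ps_0_ps_0)
    ultimately show ?case using ab by (auto intro: gen.intros)
  next
    case (Suc n)
    let ?m = "int (Suc n)"
    \<comment> \<open>Applying \<open>ps ?m\<close> lowers the bound by one: its square vanishes and
      it anticommutes with every higher \<open>ps i\<close>.\<close>
    have kill: "\<forall>i>int n. ps i (ps ?m w) = 0" if w: "\<And>i. i > ?m \<Longrightarrow> ps i w = 0" for w
    proof (intro allI impI)
      fix i assume "i > int n"
      then consider "i = ?m" | "i > ?m" by linarith
      then show "ps i (ps ?m w) = 0"
        by cases (use w ps_twice[of ?m w] ps_ps[of i ?m w] in auto)
    qed
    have "ps ?m v \<in> gen (U \<inter> vac)"
      using Suc.prems by (intro Suc.IH kill) (auto intro: ps)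
    \<comment> \<open>\<open>ps (- ?m) v\<close> is still killed above \<open>?m\<close>, as
      \<open>ps i\<close> anticommutes with \<open>ps (- ?m)\<close> for
      \<open>i > ?m\<close>.\<close>
    moreover have "ps ?m (ps (- ?m) v) \<in> gen (U \<inter> vac)"
      using Suc.prems by (intro Suc.IH kill ps) (simp_all add: ps_ps[of _ "- ?m" v] del: of_nat_Suc)
    ultimately have "scale (1 / c) (ps ?m (ps (- ?m) v) + ps (- ?m) (ps ?m v)) \<in> gen (U \<inter> vac)"
      by (intro gen.scale gen.add gen_ps[of "ps ?m v"])
    also have "ps ?m (ps (- ?m) v) + ps (- ?m) (ps ?m v) = scale c v"
      by (simp add: ps_ps[of ?m "- ?m"] del: of_nat_Suc)
    finally show ?case using level_nonzero by simp
  qed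
qed

subsection \<open>Projection to the vacuum vectors\<close>

definition pr :: "int \<Rightarrow> 'v \<Rightarrow> 'v" where
  "pr n v = scale (1 / c) (ps n (ps (- n) v))"

text \<open>Finite truncations of the infinite product of projections; the factor of largest index
  acts first.\<close>

fun prs :: "nat \<Rightarrow> 'v \<Rightarrow> 'v" where
  "prs 0 v = v"
| "prs (Suc n) v = prs n (pr (int (Suc n)) v)"

lemma pr_linear:
  "pr n (v + w) = pr n v + pr n w" "pr n (scale k v) = scale k (pr n v)" "pr n 0 = 0"
  by (auto simp: pr_def scale_right_distrib mult.commute)

lemma prs_linear:
  "prs n (v + w) = prs n v + prs n w" "prs n (scale k v) = scale k (prs n v)" "prs n 0 = 0"
  by (induction n arbitrary: v w) (auto simp: pr_linear)

lemma pr_fixed: "ps n v = 0 \<Longrightarrow> pr n v = v"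
  using level_nonzero by (simp add: pr_def ps_ps[of n "- n"])

lemma prs_fixed: "(\<And>n. n > 0 \<Longrightarrow> ps n v = 0) \<Longrightarrow> prs N v = v"
  by (induction N) (auto simp: pr_fixed)

text \<open>\<open>ps m\<close> anticommutes with both factors of \<open>pr n\<close>, and the two
  signs cancel.\<close>

lemma pr_ps_commute:
  assumes "m \<noteq> n" "m \<noteq> - n"
  shows "pr n (ps m v) = ps m (pr n v)"
proof -
  have "act x (- w) = - act x w" for x w
    using act_scale[of x "-1" w] by simp
  then have "ps n (ps (- n) (ps m v)) = ps m (ps n (ps (- n) v))"
    using assms by (simp add: ps_ps[of "- n" m] ps_ps[of n m])
  then show ?thesis by (simp add: pr_def)
qed

text \<open>The factors of index above \<open>n\<close> commute with \<open>ps (- n)\<close>; then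
  \<open>pr n\<close> kills the result because \<open>ps (- n)\<close> squares to zero.\<close>

lemma prs_neg: "0 < n \<Longrightarrow> n \<le> int N \<Longrightarrow> prs N (ps (- n) v) = 0"
proof (induction N arbitrary: v)
  case (Suc N)
  show ?case
  proof (cases "n = int (Suc N)")
    case True
    have "ps (- n) (ps (- n) v) = 0" using Suc.prems by (intro ps_twice) auto
    then have "pr n (ps (- n) v) = 0" by (simp add: pr_def)
    then show ?thesis using True by (simp add: prs_linear)
  next
    case False
    then have "pr (int (Suc N)) (ps (- n) v) = ps (- n) (pr (int (Suc N)) v)"
      using Suc.prems by (intro pr_ps_commute) auto
    then show ?thesis using Suc False by simp
  qed
qed auto

text \<open>On \<open>gen S\<close> the operators \<open>prs N\<close> eventually take values in
  \<open>D\<close>: they fix the generators and kill \<open>ps (- n) v\<close> once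
  \<open>N \<ge> n\<close>. A vector of \<open>vac\<close> is fixed by them, so it lies in
  \<open>D\<close>.\<close>

lemma gen_Int_vac:
  assumes S: "S \<subseteq> vac"
  shows "gen S \<inter> vac \<subseteq> span S"
proof
  fix u assume u: "u \<in> gen S \<inter> vac"
  define D where "D = {s + ps 0 t |s t. s \<in> span S \<and> t \<in> span S}"
  have D_add: "v + w \<in> D" if vw: "v \<in> D" "w \<in> D" for v w
  proof -
    obtain s t s' t' where "s \<in> span S" "t \<in> span S" "s' \<in> span S" "t' \<in> span S"
      "v = s + ps 0 t" "w = s' + ps 0 t'" using vw unfolding D_def by blast
    moreover from this have "v + w = (s + s') + ps 0 (t + t')" by (simp add: algebra_simps)
    ultimately show ?thesis unfolding D_def by (blast intro: span_add)
  qed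
  have D_scale: "scale k v \<in> D" if v: "v \<in> D" for k v
  proof -
    obtain s t where "s \<in> span S" "t \<in> span S" "v = s + ps 0 t" using v by (auto simp: D_def)
    moreover from this have "scale k v = scale k s + ps 0 (scale k t)"
      by (simp add: scale_right_distrib)
    ultimately show ?thesis unfolding D_def by (blast intro: span_scale)
  qed
  have D_0: "0 \<in> D"
    unfolding D_def by (rule CollectI, rule exI[of _ 0], rule exI[of _ 0]) (simp add: span_zero)
  \<comment> \<open>The threshold for \<open>N\<close> depends on the creation operators occurring
    in \<open>v\<close>; eventuality takes care of the maximum in sums.\<close>
  have "\<forall>\<^sub>F N in sequentially. prs N v \<in> D" if "v \<in> gen S" for v
    using that
  proof induction
    case zero
    then show ?case by (simp add: prs_linear D_0)
  next
    case (base s)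
    have "s = s + ps 0 0" by simp
    then have "s \<in> D" using base span_base span_zero unfolding D_def by blast
    moreover have "prs N s = s" for N using base S by (intro prs_fixed) (auto simp: vac_def)
    ultimately show ?case by simp
  next
    case (base_ps s)
    have "ps 0 s = 0 + ps 0 s" by simp
    then have "ps 0 s \<in> D" using base_ps span_base span_zero unfolding D_def by blast
    moreover have "prs N (ps 0 s) = ps 0 s" for N
      using base_ps S vac_0_ps by (intro prs_fixed) auto
    ultimately show ?case by simp
  next
    case (add v w)
    show ?case using add.IH by eventually_elim (simp add: prs_linear D_add)
  next
    case (scale v k)
    show ?case using scale.IH by eventually_elim (simp add: prs_linear D_scale)
  next
    case (neg v n)
    have "\<forall>\<^sub>F N in sequentially. nat n \<le> N" by (rule eventually_ge_at_top)
    then show ?case by eventually_elim (use neg in \<open>simp add: prs_neg D_0\<close>)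
  qed
  then have "\<forall>\<^sub>F N in sequentially. prs N u \<in> D" using u by blast
  moreover have "prs N u = u" for N using u by (intro prs_fixed) (auto simp: vac_def)
  ultimately have "u \<in> D" by simp
  then obtain s t where st: "s \<in> span S" "t \<in> span S" "u = s + ps 0 t" by (auto simp: D_def)
  then have "s \<in> part 0" "t \<in> part 0"
    using span_minimal[OF S subspace_vac] by (auto simp: vac_def)
  \<comment> \<open>\<open>ps 0 t\<close> is odd while \<open>u\<close> and \<open>s\<close> are
    even.\<close>
  then have "u = s"
    using parts_eq(1)[of u 0 s "ps 0 t"] st u ps_part[of t 0 0] subspace_0[OF subspace_part]
    by (auto simp: vac_def)
  with st show "u \<in> span S" by simp
qed

subsection \<open>Complete reducibility\<close>

text \<open>This test, by which both simplicity and independence are checked, holds because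
  \<open>U\<close> lies in \<open>gen (U \<inter> vac)\<close>.\<close>

lemma graded_submodule_trivial:
  assumes "graded_submodule scale part act U" "U \<inter> vac \<subseteq> {0}"
  shows "U = {0}"
proof -
  have "gen (U \<inter> vac) \<subseteq> {0}"
    by (rule gen_minimal) (use assms in \<open>auto simp: subspace_def\<close>)
  with graded_submodule_subset_gen[OF assms(1)] have "U \<subseteq> {0}" by blast
  moreover have "0 \<in> U" using assms(1) by (auto simp: graded_submodule_def subspace_0)
  ultimately show ?thesis by blast
qed

text \<open>A nonzero graded \<open>U\<close> inside \<open>gen {b}\<close> contains a nonzero even
  vacuum vector. It lies in \<open>span {b}\<close>, so \<open>b\<close> itself is in
  \<open>U\<close>.\<close>

lemma simple_gen:
  assumes b: "b \<in> vac" "b \<noteq> 0"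
  shows "simple_graded_submodule scale part act (gen {b})"
  unfolding simple_graded_submodule_def
proof (intro conjI allI impI)
  show "graded_submodule scale part act (gen {b})"
    using b by (intro graded_submodule_gen) auto
  show "gen {b} \<noteq> {0}" using b gen.base[of b "{b}"] by auto
  fix U assume "graded_submodule scale part act U \<and> U \<subseteq> gen {b}"
  then have U: "graded_submodule scale part act U" "U \<subseteq> gen {b}" by auto
  have sub: "subspace U" using U by (simp add: graded_submodule_def)
  show "U = {0} \<or> U = gen {b}"
  proof (cases "U \<inter> vac \<subseteq> {0}")
    case True
    then show ?thesis using graded_submodule_trivial U by blast
  next
    case False
    then obtain u where u: "u \<in> U" "u \<in> vac" "u \<noteq> 0" by blast
    then have "u \<in> span {b}" using U gen_Int_vac[of "{b}"] b by blast
    then obtain k where k: "u = scale k b" by (auto simp: span_singleton)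
    then have "b = scale (1 / k) u" using u by auto
    then have "b \<in> U" using subspace_scale[OF sub u(1)] by metis
    then have "gen {b} \<subseteq> U"
      using U by (intro gen_minimal sub) (auto simp: graded_submodule_def)
    with U show ?thesis by blast
  qed
qed

lemma completely_reducible: "completely_reducible scale part act"
proof -
  obtain B where B: "B \<subseteq> vac" "independent B" "vac \<subseteq> span B"
    using maximal_independent_subset[of vac] by blast
  define S where "S = (\<lambda>b. gen {b}) ` B"
  have simple: "simple_graded_submodule scale part act W" if "W \<in> S" for W
    using that B dependent_zero[of B] unfolding S_def by (auto intro!: simple_gen)
  have "is_direct_sum S"
  proof (rule is_direct_sumI)
    show "subspace W" if "W \<in> S" for W
      using that subspace_gen by (auto simp: S_def)
    show "span (\<Union>S) = UNIV"
    proof -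
      have closed: "ps m v \<in> span (\<Union>S)" if "v \<in> span (\<Union>S)" for m v
        using that
      proof (induction rule: span_induct_alt)
        case base
        then show ?case by (simp add: span_zero)
      next
        case (step k x y)
        then obtain b where b: "b \<in> B" "x \<in> gen {b}" by (auto simp: S_def)
        then have "ps m x \<in> gen {b}" using B by (intro gen_ps_closed) auto
        then have "ps m x \<in> span (\<Union>S)" using b by (auto simp: S_def intro: span_base)
        with step show ?case by (auto intro: span_add span_scale)
      qed
      have "B \<subseteq> \<Union>S" by (auto simp: S_def intro: gen.base)
      then have "vac \<subseteq> span (\<Union>S)" using B span_mono by blast
      then have "gen vac \<subseteq> span (\<Union>S)" using closed by (intro gen_minimal subspace_span)
      \<comment> \<open>The whole space is a graded submodule, hence generated by its even vacuum
        vectors.\<close>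
      moreover have "graded_submodule scale part act UNIV"
        using part_sum by (auto simp: graded_submodule_def)
      then have "UNIV \<subseteq> gen vac" using graded_submodule_subset_gen[of UNIV] by simp
      ultimately show ?thesis by blast
    qed
    fix W assume "W \<in> S"
    then obtain b where b: "b \<in> B" and W: "W = gen {b}" by (auto simp: S_def)
    have bv: "{b} \<subseteq> vac" and Bv: "B - {b} \<subseteq> vac" using B b by auto
    have "\<Union>(S - {W}) \<subseteq> gen (B - {b})"
    proof
      fix v assume "v \<in> \<Union>(S - {W})"
      then obtain b' where b': "b' \<in> B - {b}" "v \<in> gen {b'}" by (auto simp: S_def W)
      moreover have "gen {b'} \<subseteq> gen (B - {b})"
        using b' Bv by (intro gen_minimal subspace_gen gen_ps_closed) (auto intro: gen.base)
      ultimately show "v \<in> gen (B - {b})" by blast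
    qed
    then have "span (\<Union>(S - {W})) \<subseteq> gen (B - {b})"
      by (rule span_minimal[OF _ subspace_gen])
    \<comment> \<open>Independence of the summands reduces to that of \<open>B\<close>: even vacuum
      vectors in both submodules lie in \<open>span {b}\<close> and in
      \<open>span (B - {b})\<close>.\<close>
    moreover have "gen {b} \<inter> gen (B - {b}) = {0}"
    proof (rule graded_submodule_trivial)
      show "graded_submodule scale part act (gen {b} \<inter> gen (B - {b}))"
        using bv Bv by (intro graded_submodule_Int graded_submodule_gen)
      have "b \<notin> span (B - {b})" using B b by (auto simp: dependent_def)
      then have "span {b} \<inter> span (B - {b}) \<subseteq> {0}"
      proof -
        have "k = 0" if "scale k b \<in> span (B - {b})" for k
        proof (rule ccontr)
          assume "k \<noteq> 0"
          then have "b = scale (1 / k) (scale k b)" by simp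
          with that span_scale \<open>b \<notin> span (B - {b})\<close> show False by metis
        qed
        then show ?thesis by (auto simp: span_singleton)
      qed
      then show "gen {b} \<inter> gen (B - {b}) \<inter> vac \<subseteq> {0}"
        using gen_Int_vac[OF bv] gen_Int_vac[OF Bv] by blast
    qed
    ultimately show "W \<inter> span (\<Union>(S - {W})) \<subseteq> {0}" using W by blast
  qed
  with simple show ?thesis unfolding completely_reducible_def by blast
qed

end

theorem lemma3p9:
  fixes scale :: "complex \<Rightarrow> 'v::ab_group_add \<Rightarrow> 'v"
    and part :: "bit \<Rightarrow> 'v set"
    and act :: "fermion \<Rightarrow> 'v \<Rightarrow> 'v"
    and c :: complex
  assumes "fermion_module scale part act"
    and "smooth act"
    and "c \<noteq> 0"
    and "\<And>v. act zF v = scale c v"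
  shows "completely_reducible scale part act"
proof -
  interpret fermion_module scale part act by fact
  interpret smooth_fermion_module scale part act c
    by unfold_locales fact+
  show ?thesis by (rule completely_reducible)
qed

end
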